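(* Under the model described in the context, for every $h\in\mathbb{T}$ the filtered process $\hat I^h_n=\mathbb{E}[\mathbf 1_{[\Theta_n=h]}\mid\mathcal{F}^N_n]$ satisfies, almost surely, for every $n=1,\dots,\Gamma$, $$\hat I_n^h=\sum_{j\in\mathbb{J}_n}\frac{\sum_{s=1}^m K^{sh}(L^s)^j(1-L^s)^{Y_n-j}\,\hat I^s_{n-1}}{\sum_{s=1}^m (L^s)^j(1-L^s)^{Y_n-j}\,\hat I^s_{n-1}}\;\mathbf 1_{[\Delta N_n=j]}.$$
   Context: Let $\Gamma\in\mathbb{N}$ and let $(\Omega,\mathbf{A},\mathbf F=(\mathcal{F}_n)_{n\in\{0,\dots,\Gamma\}},\mathbb{P})$ be a filtered probability space; all processes are $\mathbf F$-adapted. Hidden factor: $\Theta=(\Theta_n)_{0\le n\le\Gamma}$ is a Markov chain with values in the finite set $\mathbb{T}=\{1,\dots,m\}$ and constant transition probabilities $K^{sh}=\mathbb{P}(\Theta_n=h\mid\Theta_{n-1}=s)$. It is Markov relative to $\mathbf F$: $\mathbb{P}(\Theta_n=h\mid\mathcal{F}_{n-1})=K^{\Theta_{n-1}h}$ for all $h\in\mathbb{T}$, $n\ge1$. Ratings: the rating categories are $\bar\Upsilon=\{1,\dots,p\}$, completed with a censoring category $0$ to $\Upsilon=\{0,\dots,p\}$. There are $Q$ entities, and $Z^q_n\in\Upsilon$ is the rating of entity $q\in\{1,\dots,Q\}$ at time $n$. Fix two ratings $r_0,r_1\in\bar\Upsilon$, $r_0\neq r_1$. The process $N$ counts the transitions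 from $r_0$ to $r_1$: $N_0=0$ and $\Delta N_n=N_n-N_{n-1}=\sum_{q\le Q}\mathbf 1_{[Z^q_{n-1}=r_0,\;Z^q_n=r_1]}$ for $n\ge 1$. $\mathbf F^N=(\mathcal{F}^N_n)_n$ is the natural filtration of $N$ augmented with the $\mathbb{P}$-null sets. For $n\ge1$, $Y_n$ is the number of active observed entities with rating $r_0$ at time $n-1$ (those that may jump to $r_1$ at time $n$); the process $Y$ is assumed $\mathbf F^N$-predictable, i.e. $Y_n$ is $\mathcal{F}^N_{n-1}$-measurable. Put $\mathbb{J}_n=\{0,\dots,Y_n\}$. Conditional transition probabilities: $L^s=\mathbb{P}(Z^q_n=r_1\mid Z^q_{n-1}=r_0,\Theta_{n-1}=s)$ for $s\in\mathbb{T}$ (not depending on $q$ or $n$). The conditional law of $\Delta N_n$ given $\mathcal{F}_{n-1}$ depends only on $(\Theta_{n-1},Y_n)$, and on $\{\Theta_{n-1}=s,Y_n=y\}$ it is the binomial distribution with parameters $(y,L^s)$. Conditionally on $\mathcal{F}_{n-1}$, the variables $\Theta_n$ and $\Delta N_n$ are independent. Conventions: $\hat I_0^h=\mathbb{E}[\mathbf 1_{[\Theta_0=h]}\mid\mathcal{F}^N_0]$; $0^0=1$; a quotient with zero denominator is taken to be $0$ (almost surely this never occurs on the corresponding event $\{\Delta N_n=j\}$). *)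

theory Defs
  imports "HOL-Probability.Probability"
begin

text \<open>\<open>real_cond_exp\<close> picks one version; \<open>cprob\<close> is only meaningful almost surely.\<close>

definition cprob :: "'a measure \<Rightarrow> 'a measure \<Rightarrow> 'a set \<Rightarrow> 'a \<Rightarrow> real" where
  "cprob M G A = real_cond_exp M G (indicator A)"

definition cond_indep_var ::
  "'a measure \<Rightarrow> 'a measure \<Rightarrow> 'b measure \<Rightarrow> ('a \<Rightarrow> 'b) \<Rightarrow> 'c measure \<Rightarrow> ('a \<Rightarrow> 'c) \<Rightarrow> bool" where
  "cond_indep_var M G S X T Y \<longleftrightarrow>
     X \<in> measurable M S \<and> Y \<in> measurable M T \<and>
     (\<forall>A\<in>sets S. \<forall>B\<in>sets T. AE \<omega> in M.
        cprob M G ((X -` A \<inter> space M) \<inter> (Y -` B \<inter> space M)) \<omega> =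
        cprob M G (X -` A \<inter> space M) \<omega> * cprob M G (Y -` B \<inter> space M) \<omega>)"

text \<open>The null sets added here are the measurable ones, so that for measurable \<open>X\<close> the result is a
  sub-sigma-algebra of \<open>M\<close> even when \<open>M\<close> is not complete.\<close>

definition aug_natural_filtration ::
  "'a measure \<Rightarrow> (nat \<Rightarrow> 'a \<Rightarrow> nat) \<Rightarrow> nat \<Rightarrow> 'a measure" where
  "aug_natural_filtration M X n =
     sigma (space M) ({X k -` A \<inter> space M | k A. k \<le> n} \<union> null_sets M)"

text \<open>Meant for \<open>n \<ge> 1\<close> and processes that are nondecreasing in \<open>n\<close>, so that the subtraction
  on \<open>nat\<close> does not truncate.\<close>

definition increment :: "(nat \<Rightarrow> 'a \<Rightarrow> nat) \<Rightarrow> nat \<Rightarrow> 'a \<Rightarrow> nat" where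
  "increment X n \<omega> = X n \<omega> - X (n - 1) \<omega>"

text \<open>All processes are indexed by \<open>nat\<close>, but nothing is assumed about them beyond the
  horizon \<open>\<Gamma>\<close>. Censored entities carry the rating 0, so the active observed entities in
  rating \<open>r0\<close> are exactly those with \<open>Z q (n - 1) \<omega> = r0\<close>.

  The elementary conditional probabilities in \<open>K_eq\<close> and \<open>L_eq\<close> are only prescribed when the
  conditioning event has positive probability, since the library sets them to 0 otherwise.\<close>

locale hidden_factor_model = prob_space M for M :: "'a measure" +
  fixes \<Gamma> :: nat
    and F :: "nat \<Rightarrow> 'a measure"
    and m :: nat
    and \<Theta> :: "nat \<Rightarrow> 'a \<Rightarrow> nat"
    and K :: "nat \<Rightarrow> nat \<Rightarrow> real"
    and p :: nat
    and Q :: nat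
    and Z :: "nat \<Rightarrow> nat \<Rightarrow> 'a \<Rightarrow> nat"
    and r0 r1 :: nat
    and N :: "nat \<Rightarrow> 'a \<Rightarrow> nat"
    and Y :: "nat \<Rightarrow> 'a \<Rightarrow> nat"
    and L :: "nat \<Rightarrow> real"
  assumes F_subalgebra: "\<And>n. n \<le> \<Gamma> \<Longrightarrow> subalgebra M (F n)"
    and F_mono: "\<And>i j. i \<le> j \<Longrightarrow> j \<le> \<Gamma> \<Longrightarrow> sets (F i) \<subseteq> sets (F j)"
    and \<Theta>_adapted: "\<And>n. n \<le> \<Gamma> \<Longrightarrow> \<Theta> n \<in> measurable (F n) (count_space {1..m})"
    and K_nonneg: "\<And>s h. s \<in> {1..m} \<Longrightarrow> h \<in> {1..m} \<Longrightarrow> 0 \<le> K s h"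
    and K_row_sum: "\<And>s. s \<in> {1..m} \<Longrightarrow> (\<Sum>h=1..m. K s h) = 1"
    and K_eq: "\<And>n s h. n \<in> {1..\<Gamma>} \<Longrightarrow> s \<in> {1..m} \<Longrightarrow> h \<in> {1..m} \<Longrightarrow>
      \<P>(\<omega> in M. \<Theta> (n - 1) \<omega> = s) > 0 \<Longrightarrow>
      \<P>(\<omega> in M. \<Theta> n \<omega> = h \<bar> \<Theta> (n - 1) \<omega> = s) = K s h"
    and \<Theta>_Markov: "\<And>n h. n \<in> {1..\<Gamma>} \<Longrightarrow> h \<in> {1..m} \<Longrightarrow>
      AE \<omega> in M. cprob M (F (n - 1)) {\<omega>\<in>space M. \<Theta> n \<omega> = h} \<omega> = K (\<Theta> (n - 1) \<omega>) h"
    and Z_adapted: "\<And>q n. q \<in> {1..Q} \<Longrightarrow> n \<le> \<Gamma> \<Longrightarrow> Z q n \<in> measurable (F n) (count_space {0..p})"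
    and r0_rating: "r0 \<in> {1..p}"
    and r1_rating: "r1 \<in> {1..p}"
    and r0_neq_r1: "r0 \<noteq> r1"
    and N_0: "\<And>\<omega>. \<omega> \<in> space M \<Longrightarrow> N 0 \<omega> = 0"
    and N_step: "\<And>n \<omega>. n \<in> {1..\<Gamma>} \<Longrightarrow> \<omega> \<in> space M \<Longrightarrow>
      N n \<omega> = N (n - 1) \<omega> + (\<Sum>q=1..Q. of_bool (Z q (n - 1) \<omega> = r0 \<and> Z q n \<omega> = r1))"
    and Y_eq: "\<And>n \<omega>. n \<in> {1..\<Gamma>} \<Longrightarrow> \<omega> \<in> space M \<Longrightarrow>
      Y n \<omega> = card {q \<in> {1..Q}. Z q (n - 1) \<omega> = r0}"
    and Y_predictable: "\<And>n. n \<in> {1..\<Gamma>} \<Longrightarrow>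
      Y n \<in> measurable (aug_natural_filtration M N (n - 1)) (count_space UNIV)"
    and L_range: "\<And>s. s \<in> {1..m} \<Longrightarrow> L s \<in> {0..1}"
    and L_eq: "\<And>q n s. q \<in> {1..Q} \<Longrightarrow> n \<in> {1..\<Gamma>} \<Longrightarrow> s \<in> {1..m} \<Longrightarrow>
      \<P>(\<omega> in M. Z q (n - 1) \<omega> = r0 \<and> \<Theta> (n - 1) \<omega> = s) > 0 \<Longrightarrow>
      \<P>(\<omega> in M. Z q n \<omega> = r1 \<bar> Z q (n - 1) \<omega> = r0 \<and> \<Theta> (n - 1) \<omega> = s) = L s"
    and increment_cond_law: "\<And>n j. n \<in> {1..\<Gamma>} \<Longrightarrow>
      AE \<omega> in M. cprob M (F (n - 1)) {\<omega>\<in>space M. increment N n \<omega> = j} \<omega> =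
        pmf (binomial_pmf (Y n \<omega>) (L (\<Theta> (n - 1) \<omega>))) j"
    and \<Theta>_increment_cond_indep: "\<And>n. n \<in> {1..\<Gamma>} \<Longrightarrow>
      cond_indep_var M (F (n - 1)) (count_space {1..m}) (\<Theta> n) (count_space UNIV) (increment N n)"

definition filtered_factor ::
  "'a measure \<Rightarrow> (nat \<Rightarrow> 'a \<Rightarrow> nat) \<Rightarrow> (nat \<Rightarrow> 'a \<Rightarrow> nat) \<Rightarrow> nat \<Rightarrow> nat \<Rightarrow> 'a \<Rightarrow> real" where
  "filtered_factor M \<Theta> N h n =
     real_cond_exp M (aug_natural_filtration M N n) (indicator {\<omega>\<in>space M. \<Theta> n \<omega> = h})"

end

theory Submission imports Defs begin

text \<open>
  Over the event \<open>\<Delta>N n = j\<close> the observed sigma-algebra at time \<open>n\<close> has the same trace as the one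
  at time \<open>n - 1\<close>. Hence on that event the filter is given by Bayes' formula: it is the ratio of the
  conditional probabilities of \<open>{\<Delta>N n = j, \<Theta> n = h}\<close> and of \<open>{\<Delta>N n = j}\<close> given the observations
  up to \<open>n - 1\<close>. Conditioning first on \<open>F (n - 1)\<close>, the model turns these two probabilities into
  functions of \<open>\<Theta> (n - 1)\<close> and \<open>Y n\<close>; projecting onto the observations then replaces the indicator
  of \<open>\<Theta> (n - 1) = s\<close> by the previous filter. The binomial coefficient cancels in the ratio.

  The null sets in the observed filtration need not belong to \<open>F\<close>, so the observed sigma-algebra is
  contained in \<open>F n\<close> only up to null sets.
\<close>

section \<open>Conditional expectations\<close>

lemma (in finite_measure) sigma_finite_subalgebraI:
  "subalgebra M G \<Longrightarrow> sigma_finite_subalgebra M G"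
  by (intro finite_measure_subalgebra_is_sigma_finite)
     (simp add: finite_measure_subalgebra_def finite_measure_subalgebra_axioms_def
        finite_measure_axioms)

lemma (in finite_measure) integrable_indicator_finite:
  "A \<in> sets M \<Longrightarrow> integrable M (indicator A :: 'a \<Rightarrow> real)"
  by (rule integrable_real_indicator) (auto simp: less_top[symmetric])

text \<open>The tower property when \<open>H\<close> lies in \<open>G\<close> only up to null sets.
  Integrals over \<open>A\<close> do not change when \<open>A\<close> is replaced by its approximant
  \<open>B\<close> in \<open>G\<close>, where the defining identity of the conditional expectation
  given \<open>G\<close> is available; passing back to \<open>A\<close> characterizes the
  conditional expectation given \<open>H\<close>.\<close>

lemma (in finite_measure) real_cond_exp_tower_null:
  assumes G: "subalgebra M G" and H: "subalgebra M H"
    and approx: "\<And>A. A \<in> sets H \<Longrightarrow> \<exists>B\<in>sets G. (A - B) \<union> (B - A) \<in> null_sets M"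
    and f: "integrable M f"
  shows "AE \<omega> in M. real_cond_exp M H (real_cond_exp M G f) \<omega> = real_cond_exp M H f \<omega>"
proof -
  interpret G: sigma_finite_subalgebra M G using G by (rule sigma_finite_subalgebraI)
  interpret H: sigma_finite_subalgebra M H using H by (rule sigma_finite_subalgebraI)
  show ?thesis
  proof (rule H.real_cond_exp_charact)
    show "integrable M (real_cond_exp M G f)" using f by (rule G.real_cond_exp_int)
    show "integrable M (real_cond_exp M H f)" using f by (rule H.real_cond_exp_int)
    fix A assume A: "A \<in> sets H"
    then obtain B where B: "B \<in> sets G" and null: "(A - B) \<union> (B - A) \<in> null_sets M"
      using approx by blast
    have AM: "A \<in> sets M" and BM: "B \<in> sets M"
      using A B G H by (auto simp: subalgebra_def)
    have "(LINT x:A|M. real_cond_exp M G f x) = (LINT x:B|M. real_cond_exp M G f x)"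
      by (rule set_integral_null_delta[OF G.real_cond_exp_int(1)[OF f] AM BM null])
    also have "\<dots> = (LINT x:B|M. f x)"
      by (rule G.real_cond_exp_intA[OF f B, symmetric])
    also have "\<dots> = (LINT x:A|M. f x)"
      by (rule set_integral_null_delta[OF f AM BM null, symmetric])
    also have "\<dots> = (LINT x:A|M. real_cond_exp M H f x)"
      by (rule H.real_cond_exp_intA[OF f A])
    finally show "(LINT x:A|M. real_cond_exp M G f x) = (LINT x:A|M. real_cond_exp M H f x)" .
  qed simp
qed

lemma (in finite_measure) cprob_nonneg:
  assumes "subalgebra M G" "A \<in> sets M"
  shows "AE \<omega> in M. 0 \<le> cprob M G A \<omega>"
proof -
  interpret G: sigma_finite_subalgebra M G using assms(1) by (rule sigma_finite_subalgebraI)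
  show ?thesis unfolding cprob_def using assms(2) by (intro G.real_cond_exp_pos) auto
qed

lemma (in finite_measure) cprob_mono:
  assumes "subalgebra M G" "A \<in> sets M" "B \<in> sets M" "A \<subseteq> B"
  shows "AE \<omega> in M. cprob M G A \<omega> \<le> cprob M G B \<omega>"
proof -
  interpret G: sigma_finite_subalgebra M G using assms(1) by (rule sigma_finite_subalgebraI)
  show ?thesis unfolding cprob_def using assms(2-)
    by (intro G.real_cond_exp_mono integrable_indicator_finite) (auto simp: indicator_def)
qed

section \<open>Bayes' formula for conditional probabilities\<close>

text \<open>The ratio is \<open>H\<close>-measurable and almost surely in the unit interval. Under
  the integral over \<open>A\<close>, the indicator of \<open>E\<close> may therefore be replaced by
  \<open>cprob M H E\<close>, which cancels the denominator; what remains is the integral of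
  \<open>cprob M H (E \<inter> B)\<close> over \<open>A\<close>.\<close>

lemma (in finite_measure) set_integral_cprob_ratio:
  assumes H: "subalgebra M H" and A: "A \<in> sets H" and E: "E \<in> sets M" and B: "B \<in> sets M"
  shows "(LINT \<omega>:A \<inter> E|M. cprob M H (E \<inter> B) \<omega> / cprob M H E \<omega>) = measure M (A \<inter> E \<inter> B)"
    and "integrable M (\<lambda>\<omega>. cprob M H (E \<inter> B) \<omega> / cprob M H E \<omega>)"
proof -
  interpret H: sigma_finite_subalgebra M H using H by (rule sigma_finite_subalgebraI)
  define R where "R \<omega> = cprob M H (E \<inter> B) \<omega> / cprob M H E \<omega>" for \<omega>
  have AM: "A \<in> sets M" using A H by (auto simp: subalgebra_def)
  have R_meas: "R \<in> borel_measurable H" unfolding R_def cprob_def by measurable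
  then have R_measM: "R \<in> borel_measurable M" by (rule measurable_from_subalg[OF H])
  have bounds: "AE \<omega> in M. 0 \<le> cprob M H (E \<inter> B) \<omega> \<and> cprob M H (E \<inter> B) \<omega> \<le> cprob M H E \<omega>"
    using cprob_nonneg[OF H, of "E \<inter> B"] cprob_mono[OF H, of "E \<inter> B" E] E B by auto
  then have R_bound: "AE \<omega> in M. norm (R \<omega>) \<le> 1"
    by eventually_elim (auto simp: R_def divide_le_eq_1)
  show "integrable M (\<lambda>\<omega>. cprob M H (E \<inter> B) \<omega> / cprob M H E \<omega>)"
    using integrable_const_bound[OF R_bound R_measM] unfolding R_def .
  have int: "integrable M (\<lambda>\<omega>. (indicator A \<omega> * R \<omega>) * indicator E \<omega>)"
    using R_measM AM E
    by (intro integrable_const_bound[of _ 1])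
       (use R_bound in \<open>auto simp: indicator_def\<close>)
  have "(LINT \<omega>:A \<inter> E|M. R \<omega>) = (\<integral>\<omega>. (indicator A \<omega> * R \<omega>) * indicator E \<omega> \<partial>M)"
    unfolding set_lebesgue_integral_def by (intro Bochner_Integration.integral_cong) (auto simp: indicator_def)
  also have "\<dots> = (\<integral>\<omega>. (indicator A \<omega> * R \<omega>) * cprob M H E \<omega> \<partial>M)"
    unfolding cprob_def using R_meas A E int
    by (intro H.real_cond_exp_intg(2)[symmetric]) auto
  also have "\<dots> = (\<integral>\<omega>. indicator A \<omega> * cprob M H (E \<inter> B) \<omega> \<partial>M)"
  proof (rule integral_cong_AE)
    show "(\<lambda>\<omega>. indicator A \<omega> * R \<omega> * cprob M H E \<omega>) \<in> borel_measurable M"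
      using R_measM AM unfolding cprob_def by measurable
    show "(\<lambda>\<omega>. indicator A \<omega> * cprob M H (E \<inter> B) \<omega>) \<in> borel_measurable M"
      using AM unfolding cprob_def by measurable
    \<comment> \<open>Where the denominator vanishes, \<open>bounds\<close> forces the numerator to
      vanish too, so the cancellation survives division by zero.\<close>
    show "AE \<omega> in M. indicator A \<omega> * R \<omega> * cprob M H E \<omega> = indicator A \<omega> * cprob M H (E \<inter> B) \<omega>"
      using bounds by eventually_elim (auto simp: R_def)
  qed
  also have "\<dots> = (\<integral>\<omega>. indicator A \<omega> * indicator (E \<inter> B) \<omega> \<partial>M)"
  proof -
    have "(\<lambda>\<omega>. indicator A \<omega> * indicator (E \<inter> B) \<omega> :: real) = indicator (A \<inter> E \<inter> B)"
      by (auto simp: indicator_def)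
    then have "integrable M (\<lambda>\<omega>. indicator A \<omega> * indicator (E \<inter> B) \<omega> :: real)"
      using AM E B by (simp add: integrable_indicator_finite)
    then show ?thesis
      unfolding cprob_def using A E B by (intro H.real_cond_exp_intg(2)) auto
  qed
  also have "\<dots> = measure M (A \<inter> E \<inter> B)"
  proof -
    have "(\<lambda>\<omega>. indicator A \<omega> * indicator (E \<inter> B) \<omega> :: real) = indicator (A \<inter> E \<inter> B)"
      by (auto simp: indicator_def)
    then show ?thesis using AM E B by simp
  qed
  finally show "(LINT \<omega>:A \<inter> E|M. cprob M H (E \<inter> B) \<omega> / cprob M H E \<omega>) = measure M (A \<inter> E \<inter> B)"
    unfolding R_def .
qed

text \<open>By \<open>trace\<close>, \<open>G\<close> carries no more information than
  \<open>H\<close> inside a cell of the partition. Testing the sum against \<open>C\<close> in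
  \<open>G\<close>, the cell \<open>E j\<close> sees only some \<open>A\<close> in \<open>H\<close>,
  so the ratio integrates to the measure of \<open>C \<inter> E j \<inter> B\<close>; these values
  add up to the measure of \<open>C \<inter> B\<close>.\<close>

theorem (in finite_measure) cprob_Bayes_partition:
  fixes D :: "'a \<Rightarrow> 'b"
  assumes G: "subalgebra M G" and H: "subalgebra M H" and sub: "sets H \<subseteq> sets G"
    and J: "finite J" "\<And>\<omega>. \<omega> \<in> space M \<Longrightarrow> D \<omega> \<in> J"
    and D: "\<And>j. j \<in> J \<Longrightarrow> {\<omega>\<in>space M. D \<omega> = j} \<in> sets G"
    and trace: "\<And>C j. C \<in> sets G \<Longrightarrow> j \<in> J \<Longrightarrow>
      \<exists>A\<in>sets H. C \<inter> {\<omega>\<in>space M. D \<omega> = j} = A \<inter> {\<omega>\<in>space M. D \<omega> = j}"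
    and B: "B \<in> sets M"
  shows "AE \<omega> in M. cprob M G B \<omega> =
    (\<Sum>j\<in>J. cprob M H ({\<omega>\<in>space M. D \<omega> = j} \<inter> B) \<omega> / cprob M H {\<omega>\<in>space M. D \<omega> = j} \<omega> *
       indicator {\<omega>\<in>space M. D \<omega> = j} \<omega>)"
proof -
  interpret G: sigma_finite_subalgebra M G using G by (rule sigma_finite_subalgebraI)
  interpret H: sigma_finite_subalgebra M H using H by (rule sigma_finite_subalgebraI)
  define E where "E j = {\<omega>\<in>space M. D \<omega> = j}" for j
  define R where "R j \<omega> = cprob M H (E j \<inter> B) \<omega> / cprob M H (E j) \<omega>" for j \<omega>
  have EG: "E j \<in> sets G" if "j \<in> J" for j using D[OF that] by (simp add: E_def)
  have EM: "E j \<in> sets M" if "j \<in> J" for j using EG[OF that] G by (auto simp: subalgebra_def)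
  have HG: "subalgebra G H" using G H sub by (simp add: subalgebra_def)
  have R_meas: "R j \<in> borel_measurable G" for j
    unfolding R_def cprob_def by (rule measurable_from_subalg[OF HG]) measurable
  have RE_int: "integrable M (\<lambda>\<omega>. R j \<omega> * indicator (E j) \<omega>)" if "j \<in> J" for j
    using integrable_mult_indicator[OF EM[OF that]
        set_integral_cprob_ratio(2)[OF H sets.empty_sets EM[OF that] B]]
    by (simp add: R_def mult.commute)
  have "AE \<omega> in M. real_cond_exp M G (indicator B) \<omega> = (\<Sum>j\<in>J. R j \<omega> * indicator (E j) \<omega>)"
  proof (rule G.real_cond_exp_charact)
    show "integrable M (indicator B :: 'a \<Rightarrow> real)" using B by (rule integrable_indicator_finite)
    show "integrable M (\<lambda>\<omega>. \<Sum>j\<in>J. R j \<omega> * indicator (E j) \<omega>)"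
      using RE_int by (intro Bochner_Integration.integrable_sum) auto
    show "(\<lambda>\<omega>. \<Sum>j\<in>J. R j \<omega> * indicator (E j) \<omega>) \<in> borel_measurable G"
      using R_meas EG by (intro borel_measurable_sum borel_measurable_times) auto
    fix C assume C: "C \<in> sets G"
    then have CM: "C \<in> sets M" using G by (auto simp: subalgebra_def)
    have part: "(LINT \<omega>:C|M. R j \<omega> * indicator (E j) \<omega>) = measure M (C \<inter> E j \<inter> B)"
      if j: "j \<in> J" for j
    proof -
      obtain A where A: "A \<in> sets H" "C \<inter> E j = A \<inter> E j"
        using trace[OF C j] unfolding E_def by blast
      have "(LINT \<omega>:C|M. R j \<omega> * indicator (E j) \<omega>) = (LINT \<omega>:C \<inter> E j|M. R j \<omega>)"
        unfolding set_lebesgue_integral_def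
        by (intro Bochner_Integration.integral_cong) (auto simp: indicator_def)
      then show ?thesis
        using set_integral_cprob_ratio(1)[OF H A(1) EM[OF j] B] A(2) by (simp add: R_def)
    qed
    have "(LINT \<omega>:C|M. (\<Sum>j\<in>J. R j \<omega> * indicator (E j) \<omega>)) =
        (\<Sum>j\<in>J. LINT \<omega>:C|M. R j \<omega> * indicator (E j) \<omega>)"
      unfolding set_lebesgue_integral_def scaleR_sum_right
      using integrable_mult_indicator[OF CM RE_int]
      by (intro Bochner_Integration.integral_sum) auto
    also have "\<dots> = (\<Sum>j\<in>J. measure M (C \<inter> E j \<inter> B))" by (simp add: part)
    \<comment> \<open>Distinct values of \<open>D\<close> give disjoint cells, hence additivity;
      since \<open>D\<close> takes all its values in \<open>J\<close>, the cells cover the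
      space.\<close>
    also have "\<dots> = measure M (\<Union>j\<in>J. C \<inter> E j \<inter> B)"
      using J(1) CM EM B
      by (intro finite_measure_finite_Union[symmetric])
         (auto simp: disjoint_family_on_def E_def)
    also have "(\<Union>j\<in>J. C \<inter> E j \<inter> B) = C \<inter> B"
      using J(2) sets.sets_into_space[OF CM] by (auto simp: E_def)
    also have "measure M (C \<inter> B) = (LINT \<omega>:C|M. indicator B \<omega>)"
    proof -
      have "(\<lambda>\<omega>. indicator C \<omega> *\<^sub>R indicator B \<omega> :: real) = indicator (C \<inter> B)"
        by (auto simp: indicator_def)
      then show ?thesis using CM B by (simp add: set_lebesgue_integral_def)
    qed
    finally show "(LINT \<omega>:C|M. indicator B \<omega>) =
        (LINT \<omega>:C|M. (\<Sum>j\<in>J. R j \<omega> * indicator (E j) \<omega>))" by simp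
  qed
  then show ?thesis unfolding cprob_def R_def E_def .
qed

section \<open>The augmented natural filtration\<close>

lemma aug_natural_filtration_generator:
  "{X k -` A \<inter> space M | k A. k \<le> n} \<union> null_sets M \<subseteq> Pow (space M)"
  by (auto dest: null_setsD2 sets.sets_into_space)

lemma space_aug_natural_filtration [simp]: "space (aug_natural_filtration M X n) = space M"
  unfolding aug_natural_filtration_def
  using aug_natural_filtration_generator by (rule space_measure_of)

lemma sets_aug_natural_filtration:
  "sets (aug_natural_filtration M X n) =
     sigma_sets (space M) ({X k -` A \<inter> space M | k A. k \<le> n} \<union> null_sets M)"
  unfolding aug_natural_filtration_def
  using aug_natural_filtration_generator by (rule sets_measure_of)

lemma aug_natural_filtration_mono:
  "n \<le> n' \<Longrightarrow> sets (aug_natural_filtration M X n) \<subseteq> sets (aug_natural_filtration M X n')"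
  unfolding sets_aug_natural_filtration by (rule sigma_sets_mono') (use order_trans in blast)

lemma measurable_aug_natural_filtration:
  "k \<le> n \<Longrightarrow> X k \<in> measurable (aug_natural_filtration M X n) (count_space UNIV)"
  by (rule measurableI) (auto simp: sets_aug_natural_filtration intro!: sigma_sets.Basic)

lemma null_sets_aug_natural_filtration:
  "A \<in> null_sets M \<Longrightarrow> A \<in> sets (aug_natural_filtration M X n)"
  by (auto simp: sets_aug_natural_filtration intro!: sigma_sets.Basic)

lemma subalgebra_aug_natural_filtration:
  assumes "\<And>k. k \<le> n \<Longrightarrow> X k \<in> measurable M (count_space UNIV)"
  shows "subalgebra M (aug_natural_filtration M X n)"
proof -
  have "{X k -` A \<inter> space M | k A. k \<le> n} \<union> null_sets M \<subseteq> sets M"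
    using measurable_sets[OF assms] by auto
  then show ?thesis
    unfolding subalgebra_def sets_aug_natural_filtration
    by (simp add: sets.sigma_sets_subset)
qed

section \<open>Null-set approximation and traces\<close>

text \<open>The symmetric difference of the unions lies in the union of the symmetric differences.
  As \<open>M\<close> may be incomplete, a subset of a null set is null only if it is measurable,
  hence the two measurability assumptions.\<close>

lemma sym_diff_null_UN:
  assumes "\<And>i::nat. (A i - B i) \<union> (B i - A i) \<in> null_sets M"
    and "(\<Union>i. A i) \<in> sets M" "(\<Union>i. B i) \<in> sets M"
  shows "((\<Union>i. A i) - (\<Union>i. B i)) \<union> ((\<Union>i. B i) - (\<Union>i. A i)) \<in> null_sets M"
proof (rule null_sets_subset)
  show "(\<Union>i. (A i - B i) \<union> (B i - A i)) \<in> null_sets M"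
    using assms(1) by (rule null_sets_UN)
qed (use assms in auto)

text \<open>The sets that agree with a member of \<open>G\<close> up to a null set are closed under
  complements and countable unions. They include the generators: events of \<open>X k\<close>
  approximate themselves, and null sets are approximated by the empty set.\<close>

lemma aug_natural_filtration_approx:
  assumes G: "subalgebra M G"
    and X: "\<And>k. k \<le> n \<Longrightarrow> X k \<in> measurable G (count_space UNIV)"
    and A: "A \<in> sets (aug_natural_filtration M X n)"
  shows "\<exists>B\<in>sets G. (A - B) \<union> (B - A) \<in> null_sets M"
proof -
  have spG: "space G = space M" and GM: "sets G \<subseteq> sets M" using G by (auto simp: subalgebra_def)
  have sub: "subalgebra M (aug_natural_filtration M X n)"
    using X by (intro subalgebra_aug_natural_filtration measurable_from_subalg[OF G])
  have augM: "A \<in> sets M"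
    if "A \<in> sigma_sets (space M) ({X k -` A \<inter> space M | k A. k \<le> n} \<union> null_sets M)" for A
    using sub that by (auto simp: subalgebra_def sets_aug_natural_filtration)
  show ?thesis
    using A unfolding sets_aug_natural_filtration
  proof (induction rule: sigma_sets.induct)
    case (Basic a)
    then consider k S where "k \<le> n" "a = X k -` S \<inter> space M" | "a \<in> null_sets M" by blast
    then show ?case
    proof cases
      case 1
      then have "a \<in> sets G" using measurable_sets[OF X, of k S] by (simp add: spG)
      then show ?thesis by (intro bexI[of _ a]) auto
    next
      case 2
      then show ?thesis by (intro bexI[of _ "{}"]) auto
    qed
  next
    case Empty
    show ?case by (intro bexI[of _ "{}"]) auto
  next
    case (Compl a)
    then obtain b where b: "b \<in> sets G" "(a - b) \<union> (b - a) \<in> null_sets M" by blast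
    \<comment> \<open>Complementing both sets inside the space leaves their symmetric difference
      unchanged.\<close>
    have "a \<subseteq> space M" "b \<subseteq> space M"
      using augM[OF Compl.hyps] b(1) GM by (auto dest: sets.sets_into_space)
    then have "((space M - a) - (space M - b)) \<union> ((space M - b) - (space M - a)) =
        (a - b) \<union> (b - a)" by auto
    moreover have "space M - b \<in> sets G" using sets.compl_sets[OF b(1)] by (simp add: spG)
    ultimately show ?case using b(2) by (intro bexI[of _ "space M - b"]) auto
  next
    case (Union a)
    then obtain b where b: "\<And>i. b i \<in> sets G" "\<And>i. (a i - b i) \<union> (b i - a i) \<in> null_sets M"
      by metis
    have "(\<Union>i. b i) \<in> sets G" using b(1) by auto
    moreover have "((\<Union>i. a i) - (\<Union>i. b i)) \<union> ((\<Union>i. b i) - (\<Union>i. a i)) \<in> null_sets M"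
      by (rule sym_diff_null_UN[OF b(2)]) (use augM[OF Union.hyps] b(1) GM in auto)
    ultimately show ?case by blast
  qed
qed

text \<open>On \<open>E\<close> the new value \<open>X (Suc n)\<close> is a fixed shift of
  \<open>X n\<close>, so observing it there reveals nothing new. Agreement on \<open>E\<close> with
  a set known at time \<open>n\<close> passes from the generators to the whole
  sigma-algebra.\<close>

lemma aug_natural_filtration_trace:
  assumes C: "C \<in> sets (aug_natural_filtration M X (Suc n))"
    and E: "\<And>\<omega>. \<omega> \<in> E \<Longrightarrow> X (Suc n) \<omega> = X n \<omega> + j"
  shows "\<exists>A\<in>sets (aug_natural_filtration M X n). C \<inter> E = A \<inter> E"
  using C unfolding sets_aug_natural_filtration[of M X "Suc n"]
proof (induction rule: sigma_sets.induct)
  case (Basic a)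
  then consider k S where "k \<le> Suc n" "a = X k -` S \<inter> space M" | "a \<in> null_sets M" by blast
  then show ?case
  proof cases
    case (1 k S)
    show ?thesis
    proof (cases "k \<le> n")
      case True
      then have "a \<in> sets (aug_natural_filtration M X n)"
        using measurable_sets[OF measurable_aug_natural_filtration, of k n S X M] 1 by simp
      then show ?thesis by blast
    next
      case False
      then have "k = Suc n" using 1 by simp
      \<comment> \<open>The witness pulls \<open>S\<close> back along the shift by \<open>j\<close>,
        turning an event of \<open>X (Suc n)\<close> into one of \<open>X n\<close>.\<close>
      then have "a \<inter> E = (X n -` {i. i + j \<in> S} \<inter> space M) \<inter> E"
        using E by (auto simp: 1)
      moreover have "X n -` {i. i + j \<in> S} \<inter> space M \<in> sets (aug_natural_filtration M X n)"
        using measurable_sets[OF measurable_aug_natural_filtration, of n n "{i. i + j \<in> S}" X M]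
        by simp
      ultimately show ?thesis by blast
    qed
  next
    case 2
    then show ?thesis using null_sets_aug_natural_filtration by blast
  qed
next
  case Empty
  show ?case by (intro bexI[of _ "{}"]) auto
next
  case (Compl a)
  then obtain b where b: "b \<in> sets (aug_natural_filtration M X n)" "a \<inter> E = b \<inter> E" by blast
  have "(space M - a) \<inter> E = (space M - b) \<inter> E" using b(2) by blast
  moreover have "space M - b \<in> sets (aug_natural_filtration M X n)"
    using sets.compl_sets[OF b(1)] by simp
  ultimately show ?case by blast
next
  case (Union a)
  then obtain b where b: "\<And>i. b i \<in> sets (aug_natural_filtration M X n)"
      "\<And>i. a i \<inter> E = b i \<inter> E"
    by metis
  have "(\<Union>i. a i) \<inter> E = (\<Union>i. b i) \<inter> E" using b(2) by blast
  moreover have "(\<Union>i. b i) \<in> sets (aug_natural_filtration M X n)" using b(1) by auto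
  ultimately show ?case by blast
qed

section \<open>The filter\<close>

context hidden_factor_model
begin

section \<open>Measurability and bounds in the model\<close>

lemma space_F: "n \<le> \<Gamma> \<Longrightarrow> space (F n) = space M"
  using F_subalgebra by (simp add: subalgebra_def)

text \<open>By induction: each step adds a finite sum determined by the ratings at two consecutive
  times, both known at the later one.\<close>

lemma N_adapted: "n \<le> \<Gamma> \<Longrightarrow> N n \<in> measurable (F n) (count_space UNIV)"
proof (induction n)
  case 0
  have "(\<lambda>\<omega>. 0) \<in> measurable (F 0) (count_space UNIV)" by simp
  moreover have "N 0 \<omega> = 0" if "\<omega> \<in> space (F 0)" for \<omega>
    using that N_0 by (simp add: space_F)
  ultimately show ?case by (rule measurable_cong[THEN iffD2, rotated])
next
  case (Suc n)
  have sub: "subalgebra (F (Suc n)) (F n)"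
    using Suc.prems F_mono[of n "Suc n"] by (simp add: subalgebra_def space_F)
  have [measurable]: "N n \<in> measurable (F (Suc n)) (count_space UNIV)"
    using Suc by (intro measurable_from_subalg[OF sub]) auto
  have Z1: "Z q n \<in> measurable (F (Suc n)) (count_space {0..p})" if "q \<in> {1..Q}" for q
    using that Suc.prems by (intro measurable_from_subalg[OF sub] Z_adapted) auto
  have Z2: "Z q (Suc n) \<in> measurable (F (Suc n)) (count_space {0..p})" if "q \<in> {1..Q}" for q
    using that Suc.prems by (intro Z_adapted) auto
  have "(\<lambda>\<omega>. N n \<omega> + (\<Sum>q=1..Q. of_bool (Z q n \<omega> = r0 \<and> Z q (Suc n) \<omega> = r1)))
      \<in> measurable (F (Suc n)) (count_space UNIV)"
  proof -
    have "(\<lambda>\<omega>. of_bool (Z q n \<omega> = r0 \<and> Z q (Suc n) \<omega> = r1) :: nat)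
        \<in> measurable (F (Suc n)) (count_space UNIV)" if "q \<in> {1..Q}" for q
    proof -
      \<comment> \<open>The target \<open>count_space {0..p}\<close> is enlarged to the full
        discrete space, where comparison with \<open>r0\<close> and \<open>r1\<close> is handled
        automatically.\<close>
      have [measurable]: "Z q n \<in> measurable (F (Suc n)) (count_space UNIV)"
          "Z q (Suc n) \<in> measurable (F (Suc n)) (count_space UNIV)"
        using measurable_compose[OF Z1[OF that], of "\<lambda>x. x" "count_space UNIV"]
          measurable_compose[OF Z2[OF that], of "\<lambda>x. x" "count_space UNIV"] by simp_all
      have "(\<lambda>\<omega>. if Z q n \<omega> = r0 \<and> Z q (Suc n) \<omega> = r1 then 1 else 0 :: nat)
          \<in> measurable (F (Suc n)) (count_space UNIV)" by measurable
      then show ?thesis by (simp add: of_bool_def)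
    qed
    then have "(\<lambda>\<omega>. \<Sum>q=1..Q. of_bool (Z q n \<omega> = r0 \<and> Z q (Suc n) \<omega> = r1) :: nat)
        \<in> measurable (F (Suc n)) (count_space UNIV)"
      by (rule measurable_sum_nat)
    then show ?thesis by measurable
  qed
  moreover have "N (Suc n) \<omega> = N n \<omega> + (\<Sum>q=1..Q. of_bool (Z q n \<omega> = r0 \<and> Z q (Suc n) \<omega> = r1))"
    if "\<omega> \<in> space (F (Suc n))" for \<omega>
    using that Suc.prems N_step[of "Suc n" \<omega>] by (simp add: space_F)
  ultimately show ?case by (rule measurable_cong[THEN iffD2, rotated])
qed

lemma N_adapted_le: "k \<le> n \<Longrightarrow> n \<le> \<Gamma> \<Longrightarrow> N k \<in> measurable (F n) (count_space UNIV)"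
  by (rule measurable_from_subalg[OF _ N_adapted]) (simp_all add: subalgebra_def space_F F_mono)

abbreviation FN :: "nat \<Rightarrow> 'a measure" where
  "FN \<equiv> aug_natural_filtration M N"

lemma subalgebra_FN: "n \<le> \<Gamma> \<Longrightarrow> subalgebra M (FN n)"
  by (intro subalgebra_aug_natural_filtration measurable_from_subalg[OF F_subalgebra N_adapted_le]) auto

text \<open>\<open>N_step\<close> makes \<open>N\<close> nondecreasing, so the subtraction in
  \<open>increment\<close> does not truncate.\<close>

lemma increment_eq:
  assumes "n \<in> {1..\<Gamma>}" "\<omega> \<in> space M"
  shows "N n \<omega> = N (n - 1) \<omega> + increment N n \<omega>"
  using N_step[OF assms] by (simp add: increment_def)

text \<open>Every transition counted at time \<open>n\<close> starts from an entity rated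
  \<open>r0\<close> at time \<open>n - 1\<close>.\<close>

lemma increment_le_Y:
  assumes "n \<in> {1..\<Gamma>}" "\<omega> \<in> space M"
  shows "increment N n \<omega> \<le> Y n \<omega>"
proof -
  have "increment N n \<omega> = (\<Sum>q=1..Q. of_bool (Z q (n - 1) \<omega> = r0 \<and> Z q n \<omega> = r1))"
    using N_step[OF assms] by (simp add: increment_def)
  also have "\<dots> \<le> (\<Sum>q=1..Q. of_bool (Z q (n - 1) \<omega> = r0))" by (rule sum_mono) auto
  also have "\<dots> = Y n \<omega>"
    using Y_eq[OF assms] by (simp add: sum.If_cases of_bool_def Int_def)
  finally show ?thesis .
qed

text \<open>\<open>Y n\<close> is random; a deterministic bound provides a fixed finite index set
  for the partition by the increment.\<close>

lemma Y_le_Q: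
  assumes "n \<in> {1..\<Gamma>}" "\<omega> \<in> space M"
  shows "Y n \<omega> \<le> Q"
proof -
  have "card {q \<in> {1..Q}. Z q (n - 1) \<omega> = r0} \<le> card {1..Q}" by (rule card_mono) auto
  then show ?thesis using Y_eq[OF assms] by simp
qed

lemma \<Theta>_in: "n \<le> \<Gamma> \<Longrightarrow> \<omega> \<in> space M \<Longrightarrow> \<Theta> n \<omega> \<in> {1..m}"
  using measurable_space[OF \<Theta>_adapted[of n], of \<omega>] by (simp add: space_F)

lemma \<Theta>_measurable: "n \<le> \<Gamma> \<Longrightarrow> \<Theta> n \<in> measurable M (count_space {1..m})"
  by (rule measurable_from_subalg[OF F_subalgebra \<Theta>_adapted])

lemma \<Theta>_event: "n \<le> \<Gamma> \<Longrightarrow> {\<omega>\<in>space M. \<Theta> n \<omega> = s} \<in> sets M"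
  using \<Theta>_measurable[of n] by measurable

lemma increment_measurable_FN:
  assumes "n \<in> {1..\<Gamma>}"
  shows "increment N n \<in> measurable (FN n) (count_space UNIV)"
proof -
  have [measurable]: "N n \<in> measurable (FN n) (count_space UNIV)"
      "N (n - 1) \<in> measurable (FN n) (count_space UNIV)"
    by (auto intro!: measurable_aug_natural_filtration)
  show ?thesis unfolding increment_def[abs_def] by measurable
qed

lemma increment_event_FN:
  assumes "n \<in> {1..\<Gamma>}"
  shows "{\<omega>\<in>space M. increment N n \<omega> = j} \<in> sets (FN n)"
proof -
  have "increment N n -` {j} \<inter> space (FN n) \<in> sets (FN n)"
    using increment_measurable_FN[OF assms] by (rule measurable_sets) simp
  moreover have "increment N n -` {j} \<inter> space (FN n) = {\<omega>\<in>space M. increment N n \<omega> = j}"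
    by auto
  ultimately show ?thesis by simp
qed

lemma increment_event:
  "n \<in> {1..\<Gamma>} \<Longrightarrow> {\<omega>\<in>space M. increment N n \<omega> = j} \<in> sets M"
  using increment_event_FN[of n j] subalgebra_FN[of n] by (auto simp: subalgebra_def)

section \<open>Projection onto the past observations\<close>

text \<open>The conditional probability given \<open>F (n - 1)\<close> splits over the states of
  \<open>\<Theta> (n - 1)\<close> into coefficients times indicators. The coefficients depend only
  on \<open>Y n\<close>, so they leave the conditional expectation given \<open>FN (n - 1)\<close>,
  and the indicators become the previous filters. The weight \<open>c\<close> lets one argument
  serve both the increment alone and its joint event with \<open>\<Theta> n\<close>.\<close>

lemma cond_exp_binomial:
  fixes c :: "nat \<Rightarrow> real"
  assumes n: "n \<in> {1..\<Gamma>}" and A: "A \<in> sets M"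
    and cprobF: "AE \<omega> in M. cprob M (F (n - 1)) A \<omega> =
      c (\<Theta> (n - 1) \<omega>) * pmf (binomial_pmf (Y n \<omega>) (L (\<Theta> (n - 1) \<omega>))) j"
  shows "AE \<omega> in M. cprob M (FN (n - 1)) A \<omega> =
      (\<Sum>s=1..m. c s * pmf (binomial_pmf (Y n \<omega>) (L s)) j * filtered_factor M \<Theta> N s (n - 1) \<omega>)"
proof -
  have n': "n - 1 \<le> \<Gamma>" using n by auto
  note subF = F_subalgebra[OF n'] and subN = subalgebra_FN[OF n']
  interpret H: sigma_finite_subalgebra M "FN (n - 1)"
    using subN by (rule sigma_finite_subalgebraI)
  define b where "b s \<omega> = c s * pmf (binomial_pmf (Y n \<omega>) (L s)) j" for s \<omega>
  define T where "T s = {\<omega>\<in>space M. \<Theta> (n - 1) \<omega> = s}" for s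
  have TM [measurable]: "T s \<in> sets M" for s unfolding T_def by (rule \<Theta>_event[OF n'])
  \<comment> \<open>Predictability of \<open>Y\<close> enters here: the coefficient is already known
    from the observations up to \<open>n - 1\<close>.\<close>
  have b_meas: "b s \<in> borel_measurable (FN (n - 1))" for s
    using measurable_compose[OF Y_predictable[OF n], of "\<lambda>y. c s * pmf (binomial_pmf y (L s)) j"]
    unfolding b_def[abs_def] by simp
  then have b_measM [measurable]: "b s \<in> borel_measurable M" for s
    by (rule measurable_from_subalg[OF subN])
  have bT_int: "integrable M (\<lambda>\<omega>. b s \<omega> * indicator (T s) \<omega>)" for s
  proof (rule integrable_const_bound[of _ "\<bar>c s\<bar>"])
    show "AE \<omega> in M. norm (b s \<omega> * indicator (T s) \<omega>) \<le> \<bar>c s\<bar>"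
      by (auto simp: b_def abs_mult indicator_def intro!: AE_I2 mult_left_le pmf_le_1)
  qed measurable
  have "AE \<omega> in M. cprob M (FN (n - 1)) A \<omega> =
      real_cond_exp M (FN (n - 1)) (cprob M (F (n - 1)) A) \<omega>"
    unfolding cprob_def
  proof (rule AE_symmetric[OF real_cond_exp_tower_null[OF subF subN]])
    show "\<exists>B\<in>sets (F (n - 1)). (C - B) \<union> (B - C) \<in> null_sets M"
      if "C \<in> sets (FN (n - 1))" for C
      using subF N_adapted_le[OF _ n'] that by (rule aug_natural_filtration_approx)
  qed (use A in \<open>rule integrable_indicator_finite\<close>)
  moreover have "AE \<omega> in M. real_cond_exp M (FN (n - 1)) (cprob M (F (n - 1)) A) \<omega> =
      real_cond_exp M (FN (n - 1)) (\<lambda>\<omega>. \<Sum>s=1..m. b s \<omega> * indicator (T s) \<omega>) \<omega>"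
  proof (rule H.real_cond_exp_cong)
    \<comment> \<open>As \<open>\<Theta> (n - 1)\<close> takes values in \<open>{1..m}\<close>,
      exactly one indicator in the sum equals 1.\<close>
    show "AE \<omega> in M. cprob M (F (n - 1)) A \<omega> = (\<Sum>s=1..m. b s \<omega> * indicator (T s) \<omega>)"
      using cprobF AE_space
    proof eventually_elim
      case (elim \<omega>)
      have "(\<Sum>s=1..m. b s \<omega> * indicator (T s) \<omega>) =
          (\<Sum>s=1..m. if s = \<Theta> (n - 1) \<omega> then b s \<omega> else 0)"
        using elim(2) by (intro sum.cong) (auto simp: T_def)
      also have "\<dots> = b (\<Theta> (n - 1) \<omega>) \<omega>"
        using \<Theta>_in[OF n' elim(2)] by (simp add: sum.delta)
      finally show ?case using elim(1) by (simp add: b_def)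
    qed
    show "cprob M (F (n - 1)) A \<in> borel_measurable M" unfolding cprob_def by simp
  qed measurable
  moreover have "AE \<omega> in M. real_cond_exp M (FN (n - 1)) (\<lambda>\<omega>. \<Sum>s=1..m. b s \<omega> * indicator (T s) \<omega>) \<omega> =
      (\<Sum>s=1..m. real_cond_exp M (FN (n - 1)) (\<lambda>\<omega>. b s \<omega> * indicator (T s) \<omega>) \<omega>)"
    using bT_int by (rule H.real_cond_exp_sum)
  moreover have "AE \<omega> in M. \<forall>s\<in>{1..m}. real_cond_exp M (FN (n - 1)) (\<lambda>\<omega>. b s \<omega> * indicator (T s) \<omega>) \<omega> =
      b s \<omega> * filtered_factor M \<Theta> N s (n - 1) \<omega>"
    unfolding filtered_factor_def T_def[symmetric]
    using H.real_cond_exp_mult[OF b_meas _ bT_int]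
    by (intro AE_finite_allI) auto
  ultimately show ?thesis
    by eventually_elim (simp add: b_def)
qed

lemma cprob_increment:
  assumes n: "n \<in> {1..\<Gamma>}"
  shows "AE \<omega> in M. cprob M (FN (n - 1)) {\<omega>\<in>space M. increment N n \<omega> = j} \<omega> =
      (\<Sum>s=1..m. pmf (binomial_pmf (Y n \<omega>) (L s)) j * filtered_factor M \<Theta> N s (n - 1) \<omega>)"
  using cond_exp_binomial[OF n increment_event[OF n], of j "\<lambda>_. 1" j] increment_cond_law[OF n, of j]
  by simp

text \<open>Conditional independence given \<open>F (n - 1)\<close> factors the joint probability;
  the Markov property supplies the weight \<open>K s h\<close> and the increment law the binomial
  factor.\<close>

lemma cprob_increment_\<Theta>:
  assumes n: "n \<in> {1..\<Gamma>}" and h: "h \<in> {1..m}"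
  shows "AE \<omega> in M. cprob M (FN (n - 1))
        ({\<omega>\<in>space M. increment N n \<omega> = j} \<inter> {\<omega>\<in>space M. \<Theta> n \<omega> = h}) \<omega> =
      (\<Sum>s=1..m. K s h * pmf (binomial_pmf (Y n \<omega>) (L s)) j * filtered_factor M \<Theta> N s (n - 1) \<omega>)"
proof (rule cond_exp_binomial[OF n])
  show "{\<omega>\<in>space M. increment N n \<omega> = j} \<inter> {\<omega>\<in>space M. \<Theta> n \<omega> = h} \<in> sets M"
    using n increment_event[OF n] \<Theta>_event by auto
  have eqs: "\<Theta> n -` {h} \<inter> space M = {\<omega>\<in>space M. \<Theta> n \<omega> = h}"
    "increment N n -` {j} \<inter> space M = {\<omega>\<in>space M. increment N n \<omega> = j}" by auto
  have "AE \<omega> in M. cprob M (F (n - 1))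
      ((\<Theta> n -` {h} \<inter> space M) \<inter> (increment N n -` {j} \<inter> space M)) \<omega> =
      cprob M (F (n - 1)) (\<Theta> n -` {h} \<inter> space M) \<omega> *
      cprob M (F (n - 1)) (increment N n -` {j} \<inter> space M) \<omega>"
    using \<Theta>_increment_cond_indep[OF n] h unfolding cond_indep_var_def by simp
  then show "AE \<omega> in M. cprob M (F (n - 1))
        ({\<omega>\<in>space M. increment N n \<omega> = j} \<inter> {\<omega>\<in>space M. \<Theta> n \<omega> = h}) \<omega> =
      K (\<Theta> (n - 1) \<omega>) h * pmf (binomial_pmf (Y n \<omega>) (L (\<Theta> (n - 1) \<omega>))) j"
    unfolding eqs Int_commute[of "{\<omega>\<in>space M. \<Theta> n \<omega> = h}"]
    using \<Theta>_Markov[OF n h] increment_cond_law[OF n, of j]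
    by eventually_elim simp
qed

section \<open>The filter recursion\<close>

lemma filter_step:
  assumes n: "n \<in> {1..\<Gamma>}" and h: "h \<in> {1..m}"
  shows "AE \<omega> in M. filtered_factor M \<Theta> N h n \<omega> =
      (\<Sum>j\<in>{0..Y n \<omega>}.
         (\<Sum>s=1..m. K s h * L s ^ j * (1 - L s) ^ (Y n \<omega> - j) * filtered_factor M \<Theta> N s (n - 1) \<omega>) /
         (\<Sum>s=1..m. L s ^ j * (1 - L s) ^ (Y n \<omega> - j) * filtered_factor M \<Theta> N s (n - 1) \<omega>) *
         indicator {\<omega>'\<in>space M. increment N n \<omega>' = j} \<omega>)"
proof -
  \<comment> \<open>The trace lemma is stated for \<open>Suc n\<close>; since \<open>n\<close> is at
    least 1, it applies at \<open>n - 1\<close>.\<close>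
  have n': "n - 1 \<le> \<Gamma>" "n \<le> \<Gamma>" and Suc: "Suc (n - 1) = n" using n by auto
  have "AE \<omega> in M. cprob M (FN n) {\<omega>\<in>space M. \<Theta> n \<omega> = h} \<omega> =
    (\<Sum>j\<in>{0..Q}. cprob M (FN (n - 1))
         ({\<omega>\<in>space M. increment N n \<omega> = j} \<inter> {\<omega>\<in>space M. \<Theta> n \<omega> = h}) \<omega> /
       cprob M (FN (n - 1)) {\<omega>\<in>space M. increment N n \<omega> = j} \<omega> *
       indicator {\<omega>\<in>space M. increment N n \<omega> = j} \<omega>)"
  proof (rule cprob_Bayes_partition)
    show "increment N n \<omega> \<in> {0..Q}" if "\<omega> \<in> space M" for \<omega>
      using increment_le_Y[OF n that] Y_le_Q[OF n that] by simp
    show "\<exists>A\<in>sets (FN (n - 1)). C \<inter> {\<omega>\<in>space M. increment N n \<omega> = j} =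
        A \<inter> {\<omega>\<in>space M. increment N n \<omega> = j}" if "C \<in> sets (FN n)" for C j
      using aug_natural_filtration_trace[of C M N "n - 1" "{\<omega>\<in>space M. increment N n \<omega> = j}" j]
        that increment_eq[OF n] unfolding Suc by blast
    show "sets (FN (n - 1)) \<subseteq> sets (FN n)" by (rule aug_natural_filtration_mono) simp
  qed (use n' in \<open>auto intro: subalgebra_FN \<Theta>_event increment_event_FN[OF n]\<close>)
  \<comment> \<open>Finitely many \<open>j\<close> allow a single exceptional null set, so that the
    rest of the argument runs at a fixed \<open>\<omega>\<close>.\<close>
  moreover have "AE \<omega> in M. \<forall>j\<in>{0..Q}.
      cprob M (FN (n - 1)) {\<omega>\<in>space M. increment N n \<omega> = j} \<omega> =
      (\<Sum>s=1..m. pmf (binomial_pmf (Y n \<omega>) (L s)) j * filtered_factor M \<Theta> N s (n - 1) \<omega>)"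
    using cprob_increment[OF n] by (intro AE_finite_allI) auto
  moreover have "AE \<omega> in M. \<forall>j\<in>{0..Q}. cprob M (FN (n - 1))
        ({\<omega>\<in>space M. increment N n \<omega> = j} \<inter> {\<omega>\<in>space M. \<Theta> n \<omega> = h}) \<omega> =
      (\<Sum>s=1..m. K s h * pmf (binomial_pmf (Y n \<omega>) (L s)) j * filtered_factor M \<Theta> N s (n - 1) \<omega>)"
    using cprob_increment_\<Theta>[OF n h] by (intro AE_finite_allI) auto
  ultimately show ?thesis
    using AE_space
  proof eventually_elim
    case (elim \<omega>)
    let ?I = "\<lambda>s. filtered_factor M \<Theta> N s (n - 1) \<omega>"
    let ?D = "\<lambda>j. indicator {\<omega>'\<in>space M. increment N n \<omega>' = j} \<omega> :: real"
    let ?num = "\<lambda>j. \<Sum>s=1..m. K s h * L s ^ j * (1 - L s) ^ (Y n \<omega> - j) * ?I s"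
    let ?den = "\<lambda>j. \<Sum>s=1..m. L s ^ j * (1 - L s) ^ (Y n \<omega> - j) * ?I s"
    let ?b = "\<lambda>s j. pmf (binomial_pmf (Y n \<omega>) (L s)) j"
    have YQ: "Y n \<omega> \<le> Q" and DY: "increment N n \<omega> \<le> Y n \<omega>"
      using Y_le_Q[OF n elim(4)] increment_le_Y[OF n elim(4)] .
    have "filtered_factor M \<Theta> N h n \<omega> =
        (\<Sum>j\<in>{0..Q}. (\<Sum>s=1..m. K s h * ?b s j * ?I s) / (\<Sum>s=1..m. ?b s j * ?I s) * ?D j)"
      using elim(1-3) by (simp add: filtered_factor_def[of M \<Theta> N h n] cprob_def)
    \<comment> \<open>Only at a fixed \<open>\<omega>\<close> can the range shrink from
      \<open>Q\<close> to \<open>Y n \<omega>\<close>: beyond it the indicator is 0, because the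
      increment is at most \<open>Y n \<omega>\<close>.\<close>
    also have "\<dots> = (\<Sum>j\<in>{0..Y n \<omega>}. (\<Sum>s=1..m. K s h * ?b s j * ?I s) / (\<Sum>s=1..m. ?b s j * ?I s) * ?D j)"
      using YQ DY by (intro sum.mono_neutral_right) (auto simp: indicator_def)
    also have "\<dots> = (\<Sum>j\<in>{0..Y n \<omega>}. ?num j / ?den j * ?D j)"
    proof (rule sum.cong[OF refl])
      fix j assume j: "j \<in> {0..Y n \<omega>}"
      define C where "C = real (Y n \<omega> choose j)"
      have C: "C \<noteq> 0" using j by (simp add: C_def)
      \<comment> \<open>The explicit binomial formula requires \<open>L s\<close> to be a
        probability. The coefficient \<open>C\<close> does not depend on \<open>s\<close>, so it
        factors out of both sums; being nonzero, it cancels even if the remaining denominator is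
        0.\<close>
      have b: "?b s j = C * (L s ^ j * (1 - L s) ^ (Y n \<omega> - j))" if "s \<in> {1..m}" for s
        using L_range[OF that] by (simp add: C_def mult.assoc)
      have num: "(\<Sum>s=1..m. K s h * ?b s j * ?I s) = C * ?num j"
        unfolding sum_distrib_left by (rule sum.cong) (auto simp: b)
      have den: "(\<Sum>s=1..m. ?b s j * ?I s) = C * ?den j"
        unfolding sum_distrib_left by (rule sum.cong) (auto simp: b)
      show "(\<Sum>s=1..m. K s h * ?b s j * ?I s) / (\<Sum>s=1..m. ?b s j * ?I s) * ?D j =
          ?num j / ?den j * ?D j"
        unfolding num den mult_divide_mult_cancel_left[OF C] ..
    qed
    finally show ?case .
  qed
qed

end

theorem proposition1:
  fixes M :: "'a measure"
    and \<Gamma> m p Q r0 r1 h :: nat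
    and F :: "nat \<Rightarrow> 'a measure"
    and \<Theta> N Y :: "nat \<Rightarrow> 'a \<Rightarrow> nat"
    and Z :: "nat \<Rightarrow> nat \<Rightarrow> 'a \<Rightarrow> nat"
    and K :: "nat \<Rightarrow> nat \<Rightarrow> real"
    and L :: "nat \<Rightarrow> real"
  assumes "hidden_factor_model M \<Gamma> F m \<Theta> K p Q Z r0 r1 N Y L"
    and "h \<in> {1..m}"
  shows "AE \<omega> in M. \<forall>n\<in>{1..\<Gamma>}.
    filtered_factor M \<Theta> N h n \<omega> =
      (\<Sum>j\<in>{0..Y n \<omega>}.
         (\<Sum>s=1..m. K s h * L s ^ j * (1 - L s) ^ (Y n \<omega> - j) * filtered_factor M \<Theta> N s (n - 1) \<omega>) /
         (\<Sum>s=1..m. L s ^ j * (1 - L s) ^ (Y n \<omega> - j) * filtered_factor M \<Theta> N s (n - 1) \<omega>) *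
         indicator {\<omega>'\<in>space M. increment N n \<omega>' = j} \<omega>)"
proof -
  interpret hidden_factor_model M \<Gamma> F m \<Theta> K p Q Z r0 r1 N Y L by fact
  \<comment> \<open>The horizon is finite, so the exceptional null sets of the single times combine
    into one.\<close>
  show ?thesis using filter_step[OF _ assms(2)] by (intro AE_finite_allI) auto
qed

end
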